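(* Let $\mu$ be the Bernoulli measure on $\Sigma^\infty$ given by $\mu([\sigma])=2^{-|\sigma|}$ for all $\sigma\in\Sigma^*$, let $f\in L^1(\Sigma^\infty,\mathcal{B}(\Sigma^\infty),\mu)$, and let $T$ be the left shift transformation on $\Sigma^\infty$. If $f$ is PSPACE $L^1$-computable, then there exists a polynomial $q$ satisfying the following: given any $m\in\mathbb{N}$, for all $n\ge 2^{q(m)}$, $$\Big\|A_n^f-\int f\,d\mu\Big\|_1\le 2^{-m}.$$
   Context: Notation: $\Sigma=\{0,1\}$; $\Sigma^*$ and $\Sigma^\infty$ are the sets of finite and infinite binary strings; for $\sigma\in\Sigma^*$, $[\sigma]$ is the set of infinite sequences with prefix $\sigma$, and $\chi_\sigma$ is its characteristic function. $\mathcal{B}(\Sigma^\infty)$ is the Borel $\sigma$-algebra. $\mathbb{N}$ is the set of positive integers; $1^n$ is $n$ in unary. $A_n^f=\frac1n\sum_{i=0}^{n-1}f\circ T^i$. A PSPACE machine is a Turing machine using space (cells of work tape and output tape) polynomial in the total input length. Rationals are given by a finite representation for which there is $c\in\mathbb{N}$ such that a rational $r$ with a representation of length $l$ satisfies $r\le 2^{l^c}$. PSPACE sequence of simple functions: a sequence $f_n:\Sigma^\infty\to\mathbb{Q}$ such that (1) there is a controlling polynomial $p$ such that for each $n$, $f_n=\sum_{i=1}^{k(n)}d_i\chi_{\sigma_i}$ for some $k(n)\in\mathbb{N}$, $d_i\in\mathbb{Q}$ and $\sigma_i\in\Sigma^{p(n)}$; (2) there is a PSPACE machine $M$ with $M(1^n,\sigma)=f_n(\sigma0^\infty)$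 if $|\sigma|\ge p(n)$, and $M(1^n,\sigma)=\,?$ otherwise. A function $f\in L^1(\Sigma^\infty,\mu)$ is PSPACE $L^1$-computable if there is a PSPACE sequence of simple functions $\langle f_n\rangle$ with $\|f-f_n\|_1\le 2^{-n}$ for all $n$. *)

theory Defs
  imports "HOL-Analysis.Analysis" "HOL-Computational_Algebra.Polynomial"
begin

text \<open>Binary strings are \<open>bool list\<close> and infinite binary sequences are \<open>nat \<Rightarrow> bool\<close>, with \<open>True\<close>
  for 1 and \<open>False\<close> for 0. The topology on \<open>nat \<Rightarrow> bool\<close> is the product topology of the
  discrete topologies, so \<open>borel\<close> is the Borel sigma-algebra of Cantor space.
  The positive integers are the \<open>n :: nat\<close> with \<open>n > 0\<close>.\<close>

definition cylinder :: "bool list \<Rightarrow> (nat \<Rightarrow> bool) set" where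
  "cylinder \<sigma> = {\<omega>. \<forall>i<length \<sigma>. \<omega> i = \<sigma> ! i}"

definition zero_extend :: "bool list \<Rightarrow> nat \<Rightarrow> bool" where
  "zero_extend \<sigma> = (\<lambda>i. if i < length \<sigma> then \<sigma> ! i else False)"

definition left_shift :: "(nat \<Rightarrow> bool) \<Rightarrow> nat \<Rightarrow> bool" where
  "left_shift \<omega> = (\<lambda>i. \<omega> (Suc i))"

definition ergodic_average :: "((nat \<Rightarrow> bool) \<Rightarrow> real) \<Rightarrow> nat \<Rightarrow> (nat \<Rightarrow> bool) \<Rightarrow> real" where
  "ergodic_average f n \<omega> = (1 / real n) * (\<Sum>i<n. f ((left_shift ^^ i) \<omega>))"

definition l1_norm :: "(nat \<Rightarrow> bool) measure \<Rightarrow> ((nat \<Rightarrow> bool) \<Rightarrow> real) \<Rightarrow> real" where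
  "l1_norm \<mu> g = (LINT \<omega>|\<mu>. \<bar>g \<omega>\<bar>)"

text \<open>A polynomial function on the positive integers with values in \<open>nat\<close>. Real coefficients are
  allowed so that integer-valued polynomials such as \<open>n\<^sup>2 - n\<close> or \<open>n (n + 1) / 2\<close> are covered;
  the value at 0 is unconstrained.\<close>

definition polynomial_fun :: "(nat \<Rightarrow> nat) \<Rightarrow> bool" where
  "polynomial_fun p \<longleftrightarrow> (\<exists>P :: real poly. \<forall>n>0. real (p n) = poly P (real n))"


text \<open>Deterministic Turing machines with a read-only input tape, one work tape (infinite to the
  right) and a write-only output tape. States are \<open>0, \<dots>, num_states - 1\<close> with start state 0; work
  symbols are \<open>0, \<dots>, num_symbols - 1\<close> with blank 0. The machine halts when the transition function
  yields \<open>None\<close>. A transition gives the new state, the move of the input head, the symbol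
  written to the work tape, the move of the work head, and possibly a symbol appended to the
  output.\<close>

datatype input_symbol = Input_Bit bool | Comma | Left_End | Right_End

datatype output_symbol = Output_Bit bool | Question_Mark

datatype direction = Go_Left | Stay | Go_Right

record turing_machine =
  num_states :: nat
  num_symbols :: nat
  transition :: "nat \<Rightarrow> input_symbol \<Rightarrow> nat \<Rightarrow>
    (nat \<times> direction \<times> nat \<times> direction \<times> output_symbol option) option"

definition wf_turing_machine :: "turing_machine \<Rightarrow> bool" where
  "wf_turing_machine M \<longleftrightarrow> num_states M > 0 \<and> num_symbols M > 0 \<and>
     (\<forall>q a s q' d s' e b. q < num_states M \<longrightarrow> s < num_symbols M \<longrightarrow>
        transition M q a s = Some (q', d, s', e, b) \<longrightarrow> q' < num_states M \<and> s' < num_symbols M)"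

record configuration =
  state :: nat
  input_head :: nat
  work_tape :: "nat \<Rightarrow> nat"
  work_head :: nat
  output_tape :: "output_symbol list"

definition input_tape :: "bool list \<times> bool list \<Rightarrow> input_symbol list" where
  "input_tape x = [Left_End] @ map Input_Bit (fst x) @ [Comma] @ map Input_Bit (snd x) @ [Right_End]"

fun move_head :: "direction \<Rightarrow> nat \<Rightarrow> nat" where
  "move_head Go_Left i = i - 1"
| "move_head Stay i = i"
| "move_head Go_Right i = i + 1"

definition initial_configuration :: configuration where
  "initial_configuration =
     \<lparr>state = 0, input_head = 0, work_tape = (\<lambda>_. 0), work_head = 0, output_tape = []\<rparr>"

text \<open>The input head is confined to the delimited input: since input cells are not counted as
  space, an unbounded head position would otherwise be free memory.\<close>

definition next_configuration ::
  "turing_machine \<Rightarrow> bool list \<times> bool list \<Rightarrow> configuration \<Rightarrow> configuration option" where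
  "next_configuration M x c =
     (case transition M (state c) (input_tape x ! input_head c) (work_tape c (work_head c)) of
        None \<Rightarrow> None
      | Some (q, d, s, e, b) \<Rightarrow> Some
         \<lparr>state = q,
          input_head = min (move_head d (input_head c)) (length (input_tape x) - 1),
          work_tape = (work_tape c)(work_head c := s),
          work_head = move_head e (work_head c),
          output_tape = output_tape c @ (case b of None \<Rightarrow> [] | Some a \<Rightarrow> [a])\<rparr>)"

definition reachable ::
  "turing_machine \<Rightarrow> bool list \<times> bool list \<Rightarrow> configuration \<Rightarrow> bool" where
  "reachable M x c \<longleftrightarrow>
     (\<lambda>c c'. next_configuration M x c = Some c')\<^sup>*\<^sup>* initial_configuration c"

definition computes_output ::
  "turing_machine \<Rightarrow> bool list \<times> bool list \<Rightarrow> output_symbol list \<Rightarrow> bool" where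
  "computes_output M x w \<longleftrightarrow>
     (\<exists>c. reachable M x c \<and> next_configuration M x c = None \<and> output_tape c = w)"

text \<open>As the work tape starts at cell 0, the number of work cells visited is one more than the
  largest work head position, so \<open>s\<close> bounds both the work and the output cells used.\<close>

definition runs_in_space :: "turing_machine \<Rightarrow> bool list \<times> bool list \<Rightarrow> nat \<Rightarrow> bool" where
  "runs_in_space M x s \<longleftrightarrow>
     (\<forall>c. reachable M x c \<longrightarrow> work_head c + 1 + length (output_tape c) \<le> s)"

definition pspace_machine :: "turing_machine \<Rightarrow> bool" where
  "pspace_machine M \<longleftrightarrow> wf_turing_machine M \<and>
     (\<exists>p. polynomial_fun p \<and> (\<forall>u v. runs_in_space M (u, v) (p (length u + length v))))"


text \<open>\<open>rep w = Some r\<close> means that the string \<open>w\<close> represents the rational \<open>r\<close>; a rational may have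
  several representations.\<close>

definition rat_representation :: "(bool list \<Rightarrow> rat option) \<Rightarrow> bool" where
  "rat_representation rep \<longleftrightarrow>
     (\<forall>r. \<exists>w. rep w = Some r) \<and>
     (\<exists>c>0. \<forall>w r. rep w = Some r \<longrightarrow> r \<le> 2 ^ (length w ^ c))"

definition computes_rat ::
  "(bool list \<Rightarrow> rat option) \<Rightarrow> turing_machine \<Rightarrow> bool list \<times> bool list \<Rightarrow> rat \<Rightarrow> bool" where
  "computes_rat rep M x r \<longleftrightarrow>
     (\<exists>w. rep w = Some r \<and> computes_output M x (map Output_Bit w))"

definition pspace_simple_sequence ::
  "(bool list \<Rightarrow> rat option) \<Rightarrow> (nat \<Rightarrow> (nat \<Rightarrow> bool) \<Rightarrow> rat) \<Rightarrow> bool" where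
  "pspace_simple_sequence rep F \<longleftrightarrow>
     (\<exists>p. polynomial_fun p \<and>
        (\<forall>n>0. \<exists>k>0. \<exists>d :: nat \<Rightarrow> rat. \<exists>s :: nat \<Rightarrow> bool list.
           (\<forall>i\<in>{1..k}. length (s i) = p n) \<and>
           (\<forall>\<omega>. F n \<omega> = (\<Sum>i=1..k. d i * indicator (cylinder (s i)) \<omega>))) \<and>
        (\<exists>M. pspace_machine M \<and>
           (\<forall>n>0. \<forall>\<sigma>.
              (if length \<sigma> \<ge> p n
               then computes_rat rep M (replicate n True, \<sigma>) (F n (zero_extend \<sigma>))
               else computes_output M (replicate n True, \<sigma>) [Question_Mark]))))"

definition pspace_L1_computable ::
  "(bool list \<Rightarrow> rat option) \<Rightarrow> (nat \<Rightarrow> bool) measure \<Rightarrow> ((nat \<Rightarrow> bool) \<Rightarrow> real) \<Rightarrow> bool" where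
  "pspace_L1_computable rep \<mu> f \<longleftrightarrow> integrable \<mu> f \<and>
     (\<exists>F. pspace_simple_sequence rep F \<and>
        (\<forall>n>0. l1_norm \<mu> (\<lambda>\<omega>. f \<omega> - of_rat (F n \<omega>)) \<le> 1 / 2 ^ n))"

end

theory Submission
  imports Defs "HOL-Probability.Probability_Measure"
begin

text \<open>Approximate \<open>f\<close> in \<open>L\<^sup>1\<close> up to \<open>1 / 2 ^ (m + 2)\<close> by the member \<open>g\<close> of index \<open>m + 2\<close> of its
  simple sequence, which depends only on the first \<open>p (m + 2)\<close> bits. Since the shift preserves
  \<open>\<mu>\<close>, replacing \<open>f\<close> by \<open>g\<close> in the ergodic average and in the integral costs at most
  \<open>1 / 2 ^ (m + 1)\<close>. As \<open>g\<close> is constant on cylinders of measure \<open>1 / 2 ^ p (m + 2)\<close>, its supremum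
  is at most \<open>2 ^ p (m + 2)\<close> times its \<open>L\<^sup>1\<close> norm, which is bounded independently of \<open>m\<close>.
  Compositions of \<open>g\<close> with shift powers at least \<open>p (m + 2)\<close> apart are independent, so the variance
  of the Birkhoff sum is linear in its length, and \<open>n \<ge> 2 ^ q m\<close> suffices for
  \<open>q m = 4 p (m + 2) + 2 m + O(1)\<close>.\<close>

section \<open>Shift powers and cylinders\<close>

lemma funpow_left_shift: "(left_shift ^^ k) \<omega> = (\<lambda>i. \<omega> (i + k))"
  by (induction k) (auto simp: left_shift_def)

lemma measurable_left_shift [measurable]: "left_shift \<in> borel \<rightarrow>\<^sub>M borel"
  unfolding left_shift_def
  by (intro borel_measurable_continuous_onI continuous_on_coordinatewise_then_product) simp

lemma measurable_funpow_left_shift [measurable]: "left_shift ^^ k \<in> borel \<rightarrow>\<^sub>M borel"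
proof (induction k)
  case (Suc k)
  from measurable_comp[OF this measurable_left_shift] show ?case by (simp only: funpow.simps)
qed (simp add: id_def)

lemma cylinder_Nil [simp]: "cylinder [] = UNIV"
  by (simp add: cylinder_def)

text \<open>The source of independence below: lengths add under concatenation, so the masses of a
  prefix condition and of a tail condition will multiply.\<close>

lemma cylinder_append:
  "cylinder (\<sigma> @ \<tau>) = cylinder \<sigma> \<inter> (left_shift ^^ length \<sigma>) -` cylinder \<tau>"
proof (intro set_eqI iffI)
  fix \<omega> assume w: "\<omega> \<in> cylinder (\<sigma> @ \<tau>)"
  have "\<omega> (i + length \<sigma>) = \<tau> ! i" if "i < length \<tau>" for i
    using w that by (auto simp: cylinder_def nth_append dest: spec[of _ "i + length \<sigma>"])
  moreover have "\<omega> i = \<sigma> ! i" if "i < length \<sigma>" for i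
    using w that by (auto simp: cylinder_def nth_append dest: spec[of _ i])
  ultimately show "\<omega> \<in> cylinder \<sigma> \<inter> (left_shift ^^ length \<sigma>) -` cylinder \<tau>"
    by (simp add: cylinder_def funpow_left_shift)
next
  fix \<omega> assume w: "\<omega> \<in> cylinder \<sigma> \<inter> (left_shift ^^ length \<sigma>) -` cylinder \<tau>"
  have "\<omega> i = \<tau> ! (i - length \<sigma>)" if "\<not> i < length \<sigma>" "i < length \<sigma> + length \<tau>" for i
    using w that by (auto simp: cylinder_def funpow_left_shift dest: spec[of _ "i - length \<sigma>"])
  with w show "\<omega> \<in> cylinder (\<sigma> @ \<tau>)"
    by (auto simp: cylinder_def nth_append)
qed

text \<open>Solves membership for \<open>\<sigma>\<close>: a sequence lies in exactly one cylinder
  of each length, so sums over strings of fixed length collapse to one term.\<close>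

lemma cylinder_iff_map: "\<omega> \<in> cylinder \<sigma> \<longleftrightarrow> \<sigma> = map \<omega> [0..<length \<sigma>]"
proof
  assume "\<omega> \<in> cylinder \<sigma>"
  then show "\<sigma> = map \<omega> [0..<length \<sigma>]"
    by (intro nth_equalityI) (simp_all add: cylinder_def)
next
  assume eq: "\<sigma> = map \<omega> [0..<length \<sigma>]"
  have "\<omega> i = \<sigma> ! i" if "i < length \<sigma>" for i
  proof -
    have "\<sigma> ! i = map \<omega> [0..<length \<sigma>] ! i" by (rule arg_cong[OF eq])
    also have "\<dots> = \<omega> i" using that by simp
    finally show ?thesis by (rule sym)
  qed
  then show "\<omega> \<in> cylinder \<sigma>" by (simp add: cylinder_def)
qed

text \<open>Either the shorter string is a prefix of the longer one, and the cylinders are nested,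
  or the strings differ at some position, and no sequence can match both there.\<close>

lemma cylinder_Int_cylinder:
  assumes "length \<sigma> \<le> length \<tau>"
  shows "cylinder \<sigma> \<inter> cylinder \<tau> = {} \<or> cylinder \<sigma> \<inter> cylinder \<tau> = cylinder \<tau>"
proof (cases "take (length \<sigma>) \<tau> = \<sigma>")
  case True
  then have "\<sigma> @ drop (length \<sigma>) \<tau> = \<tau>"
    using append_take_drop_id[of "length \<sigma>" \<tau>] by (simp only:)
  with cylinder_append[of \<sigma> "drop (length \<sigma>) \<tau>"] have "cylinder \<tau> \<subseteq> cylinder \<sigma>"
    by (simp only: Int_lower1)
  then show ?thesis by blast
next
  case False
  then obtain i where "i < length \<sigma>" "\<tau> ! i \<noteq> \<sigma> ! i"
    using assms by (auto simp: list_eq_iff_nth_eq)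
  then have "cylinder \<sigma> \<inter> cylinder \<tau> = {}"
    using assms by (auto simp: cylinder_def)
  then show ?thesis by blast
qed

text \<open>The empty set joins the generator because incomparable strings have disjoint
  cylinders.\<close>

lemma Int_stable_cylinders: "Int_stable (insert {} (range cylinder))"
proof (rule Int_stableI)
  fix a b assume "a \<in> insert {} (range cylinder)" "b \<in> insert {} (range cylinder)"
  moreover have "cylinder \<sigma> \<inter> cylinder \<tau> \<in> insert {} (range cylinder)" for \<sigma> \<tau>
    using cylinder_Int_cylinder[of \<sigma> \<tau>] cylinder_Int_cylinder[of \<tau> \<sigma>]
    by (metis insertCI Int_commute nat_le_linear rangeI)
  ultimately show "a \<inter> b \<in> insert {} (range cylinder)" by auto
qed

lemma cylinder_sets_borel [measurable]: "cylinder \<sigma> \<in> sets borel"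
proof -
  have "open {\<omega> :: nat \<Rightarrow> bool. \<omega> i = b}" for i b
    using open_vimage[of "{b}" "\<lambda>\<omega> :: nat \<Rightarrow> bool. \<omega> i"]
    by (simp add: vimage_def open_discrete)
  then have "open (\<Inter>i<length \<sigma>. {\<omega>. \<omega> i = \<sigma> ! i})" by blast
  moreover have "cylinder \<sigma> = (\<Inter>i<length \<sigma>. {\<omega>. \<omega> i = \<sigma> ! i})"
    by (auto simp: cylinder_def)
  ultimately show ?thesis by simp
qed

section \<open>Cylinders generate the Borel sets\<close>

lemma finite_bool_lists [simp]: "finite {\<sigma> :: bool list. length \<sigma> = n}"
  using finite_lists_length_eq[of "UNIV :: bool set" n] by simp

text \<open>A basic open set of the product topology restricts only finitely many coordinates, so
  fixing all bits below a common bound \<open>n\<close> of these coordinates suffices.\<close>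

lemma open_contains_cylinder:
  fixes U :: "(nat \<Rightarrow> bool) set"
  assumes "open U" "\<omega> \<in> U"
  obtains n where "cylinder (map \<omega> [0..<n]) \<subseteq> U"
proof -
  have "openin (product_topology (\<lambda>_. euclidean) UNIV) U"
    using \<open>open U\<close> by (simp add: open_fun_def)
  from product_topology_open_contains_basis[OF this \<open>\<omega> \<in> U\<close>]
  obtain X where X: "\<omega> \<in> (\<Pi>\<^sub>E i\<in>UNIV. X i)" "finite {i. X i \<noteq> UNIV}" "(\<Pi>\<^sub>E i\<in>UNIV. X i) \<subseteq> U"
    by auto
  obtain n where n: "\<And>i. X i \<noteq> UNIV \<Longrightarrow> i < n"
    using X(2) by (auto simp: finite_nat_set_iff_bounded)
  have "cylinder (map \<omega> [0..<n]) \<subseteq> (\<Pi>\<^sub>E i\<in>UNIV. X i)"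
  proof
    fix \<omega>' assume w: "\<omega>' \<in> cylinder (map \<omega> [0..<n])"
    have "\<omega>' i \<in> X i" for i
      by (cases "i < n") (use w n X(1) in \<open>auto simp: cylinder_def PiE_iff\<close>)
    then show "\<omega>' \<in> (\<Pi>\<^sub>E i\<in>UNIV. X i)" by (simp add: PiE_iff)
  qed
  then show ?thesis using X(3) by (rule that[OF order_trans])
qed

lemma sets_borel_eq_sigma_cylinders:
  "sets (borel :: (nat \<Rightarrow> bool) measure) = sigma_sets UNIV (insert {} (range cylinder))"
  (is "_ = sigma_sets _ ?E")
proof
  let ?N = "sigma UNIV ?E"
  have N: "sets ?N = sigma_sets UNIV ?E" by simp
  have "U \<in> sets ?N" if "open U" for U :: "(nat \<Rightarrow> bool) set"
  proof -
    \<comment> \<open>There are only countably many bit lists, so this union is countable and stays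
      in the generated sigma-algebra.\<close>
    have "U = \<Union> (cylinder ` {\<sigma>. cylinder \<sigma> \<subseteq> U})"
    proof (intro set_eqI iffI)
      fix \<omega> assume "\<omega> \<in> U"
      with that obtain n where "cylinder (map \<omega> [0..<n]) \<subseteq> U"
        by (rule open_contains_cylinder)
      moreover have "\<omega> \<in> cylinder (map \<omega> [0..<n])" by (simp add: cylinder_iff_map)
      ultimately show "\<omega> \<in> \<Union> (cylinder ` {\<sigma>. cylinder \<sigma> \<subseteq> U})" by blast
    qed auto
    moreover have "cylinder \<sigma> \<in> sets ?N" for \<sigma>
      unfolding N by (intro sigma_sets.Basic) simp
    ultimately show ?thesis
      by (metis (no_types, lifting) countableI_type sets.countable_UN'')
  qed
  then have "sigma_sets UNIV {U. open U} \<subseteq> sets ?N"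
    using sets.sigma_sets_subset[of "{U. open U}" ?N] by (auto simp: space_measure_of_conv)
  then show "sets (borel :: (nat \<Rightarrow> bool) measure) \<subseteq> sigma_sets UNIV ?E"
    unfolding N by (simp add: borel_def)
  show "sigma_sets UNIV ?E \<subseteq> sets (borel :: (nat \<Rightarrow> bool) measure)"
    using sets.sigma_sets_subset[of ?E "borel :: (nat \<Rightarrow> bool) measure"] cylinder_sets_borel
    by (simp add: image_subset_iff)
qed

section \<open>Functions determined by finitely many bits\<close>

definition depends_on_prefix :: "nat \<Rightarrow> ((nat \<Rightarrow> bool) \<Rightarrow> 'a) \<Rightarrow> bool" where
  "depends_on_prefix p h \<longleftrightarrow> (\<forall>\<omega> \<omega>'. (\<forall>i<p. \<omega> i = \<omega>' i) \<longrightarrow> h \<omega> = h \<omega>')"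

lemma depends_on_prefix_mono: "depends_on_prefix p h \<Longrightarrow> p \<le> k \<Longrightarrow> depends_on_prefix k h"
  unfolding depends_on_prefix_def
proof (intro allI impI)
  fix \<omega> \<omega>' :: "nat \<Rightarrow> bool"
  assume "\<forall>\<omega> \<omega>'. (\<forall>i<p. \<omega> i = \<omega>' i) \<longrightarrow> h \<omega> = h \<omega>'" "p \<le> k" "\<forall>i<k. \<omega> i = \<omega>' i"
  then show "h \<omega> = h \<omega>'" by (simp add: order_less_le_trans)
qed

lemma depends_on_prefix_comp: "depends_on_prefix p h \<Longrightarrow> depends_on_prefix p (\<lambda>\<omega>. \<phi> (h \<omega>))"
  unfolding depends_on_prefix_def
proof (intro allI impI)
  fix \<omega> \<omega>' :: "nat \<Rightarrow> bool"
  assume "\<forall>\<omega> \<omega>'. (\<forall>i<p. \<omega> i = \<omega>' i) \<longrightarrow> h \<omega> = h \<omega>'" "\<forall>i<p. \<omega> i = \<omega>' i"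
  then have "h \<omega> = h \<omega>'" by simp
  then show "\<phi> (h \<omega>) = \<phi> (h \<omega>')" by simp
qed

text \<open>Exactly one cylinder of length \<open>p\<close> contains a given sequence, and
  \<open>zero_extend\<close> supplies a representative of it at which \<open>h\<close> takes the
  same value.\<close>

lemma depends_on_prefix_expansion:
  fixes h :: "(nat \<Rightarrow> bool) \<Rightarrow> real"
  assumes "depends_on_prefix p h"
  shows "h = (\<lambda>\<omega>. \<Sum>\<sigma> | length \<sigma> = p. h (zero_extend \<sigma>) * indicator (cylinder \<sigma>) \<omega>)"
proof
  fix \<omega> :: "nat \<Rightarrow> bool"
  let ?s = "map \<omega> [0..<p]"
  have "(\<Sum>\<sigma> | length \<sigma> = p. h (zero_extend \<sigma>) * indicator (cylinder \<sigma>) \<omega>) =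
      (\<Sum>\<sigma> | length \<sigma> = p. if \<sigma> = ?s then h (zero_extend \<sigma>) else 0)"
    by (intro sum.cong) (auto simp: indicator_def cylinder_iff_map)
  also have "\<dots> = h (zero_extend ?s)" by simp
  also have "\<dots> = h \<omega>"
    using assms unfolding depends_on_prefix_def by (auto simp: zero_extend_def)
  finally show "h \<omega> = (\<Sum>\<sigma> | length \<sigma> = p. h (zero_extend \<sigma>) * indicator (cylinder \<sigma>) \<omega>)"
    by (rule sym)
qed

lemma depends_on_prefix_measurable:
  fixes h :: "(nat \<Rightarrow> bool) \<Rightarrow> real"
  assumes "depends_on_prefix p h"
  shows "h \<in> borel_measurable borel"
  by (subst depends_on_prefix_expansion[OF assms])
    (intro borel_measurable_sum borel_measurable_times borel_measurable_const
      borel_measurable_indicator cylinder_sets_borel)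

section \<open>The Bernoulli measure: uniqueness and shift invariance\<close>

locale bernoulli_measure =
  fixes \<mu> :: "(nat \<Rightarrow> bool) measure"
  assumes sets_eq_borel [measurable_cong]: "sets \<mu> = sets borel"
    and emeasure_cylinder: "\<And>\<sigma>. emeasure \<mu> (cylinder \<sigma>) = ennreal (1 / 2 ^ length \<sigma>)"
begin

lemma space_eq_UNIV [simp]: "space \<mu> = UNIV"
  using sets_eq_imp_space_eq[OF sets_eq_borel] by simp

sublocale prob_space \<mu>
  by standard (use emeasure_cylinder[of "[]"] in simp)

lemma measure_cylinder: "measure \<mu> (cylinder \<sigma>) = 1 / 2 ^ length \<sigma>"
  by (simp add: measure_def emeasure_cylinder)

text \<open>Uniqueness of measures on an intersection-stable generator. The exhausting sequence is
  constantly \<open>UNIV\<close>, the cylinder of the empty string, which has mass 1.\<close>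

lemma measure_eq_bernoulli:
  assumes "sets N = sets borel"
    and "\<And>\<sigma>. emeasure N (cylinder \<sigma>) = ennreal (1 / 2 ^ length \<sigma>)"
  shows "N = \<mu>"
proof (rule measure_eqI_generator_eq[where \<Omega> = UNIV and A = "\<lambda>_. UNIV"])
  show "Int_stable (insert {} (range cylinder))" by (rule Int_stable_cylinders)
  show "range (\<lambda>_::nat. UNIV) \<subseteq> insert {} (range cylinder)"
    using rangeI[of cylinder "[]"] by simp
  show "emeasure N UNIV \<noteq> \<infinity>" using assms(2)[of "[]"] by simp
  show "sets N = sigma_sets UNIV (insert {} (range cylinder))"
    "sets \<mu> = sigma_sets UNIV (insert {} (range cylinder))"
    by (simp_all only: assms(1) sets_eq_borel sets_borel_eq_sigma_cylinders)
  show "emeasure N X = emeasure \<mu> X" if "X \<in> insert {} (range cylinder)" for X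
    using that by (elim insertE rangeE) (simp_all only: assms(2) emeasure_cylinder emeasure_empty)
qed simp_all

text \<open>Conditioning on the first bits being \<open>\<sigma>\<close> and then deleting them
  gives back \<open>\<mu>\<close>. This states the independence of prefix and tail as an identity of
  measures, so that it transfers to integrals.\<close>

lemma distr_shift_conditioned:
  "distr (density \<mu> (\<lambda>\<omega>. ennreal (2 ^ length \<sigma> * indicator (cylinder \<sigma>) \<omega>))) borel
     (left_shift ^^ length \<sigma>) = \<mu>" (is "distr ?D _ _ = _")
proof (rule measure_eq_bernoulli)
  fix \<tau>
  let ?A = "(left_shift ^^ length \<sigma>) -` cylinder \<tau>"
  have A: "?A \<in> sets borel"
    using measurable_sets[OF measurable_funpow_left_shift, of "cylinder \<tau>" "length \<sigma>"] by simp
  have "emeasure (distr ?D borel (left_shift ^^ length \<sigma>)) (cylinder \<tau>) = emeasure ?D ?A"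
    by (subst emeasure_distr) simp_all
  \<comment> \<open>The indicator in the density and that of the preimage multiply to the indicator
    of the cylinder of the concatenated string.\<close>
  also have "\<dots> = (\<integral>\<^sup>+ \<omega>. ennreal (2 ^ length \<sigma>) * indicator (cylinder (\<sigma> @ \<tau>)) \<omega> \<partial>\<mu>)"
    using A by (subst emeasure_density)
      (auto simp: sets_eq_borel cylinder_append indicator_def intro!: nn_integral_cong)
  also have "\<dots> = ennreal (2 ^ length \<sigma>) * ennreal (1 / 2 ^ (length \<sigma> + length \<tau>))"
    by (subst nn_integral_cmult_indicator) (simp_all add: sets_eq_borel emeasure_cylinder)
  also have "\<dots> = ennreal (1 / 2 ^ length \<tau>)"
    by (subst ennreal_mult[symmetric]) (simp_all add: power_add)
  finally show "emeasure (distr ?D borel (left_shift ^^ length \<sigma>)) (cylinder \<tau>) = \<dots>" .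
qed simp

text \<open>For one step, the preimage of a cylinder is the disjoint union, over the deleted bit, of
  two cylinders of half its mass. Iterated pushforward gives all powers.\<close>

lemma distr_shift: "distr \<mu> borel (left_shift ^^ k) = \<mu>"
proof (induction k)
  case 0
  show ?case by (simp add: distr_id2 sets_eq_borel)
next
  case (Suc k)
  have shift: "distr \<mu> borel left_shift = \<mu>"
  proof (rule measure_eq_bernoulli)
    fix \<tau>
    have "left_shift -` cylinder \<tau> = cylinder (True # \<tau>) \<union> cylinder (False # \<tau>)"
      using cylinder_append[of "[True]" \<tau>] cylinder_append[of "[False]" \<tau>]
      by (auto simp: cylinder_def)
    moreover have "cylinder (True # \<tau>) \<inter> cylinder (False # \<tau>) = {}"
      by (auto simp: cylinder_def)
    ultimately have "emeasure \<mu> (left_shift -` cylinder \<tau>) =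
        ennreal (1 / 2 ^ Suc (length \<tau>)) + ennreal (1 / 2 ^ Suc (length \<tau>))"
      by (simp add: plus_emeasure[symmetric] emeasure_cylinder sets_eq_borel)
    also have "\<dots> = ennreal (1 / 2 ^ length \<tau>)"
      by (subst ennreal_plus[symmetric]) simp_all
    finally show "emeasure (distr \<mu> borel left_shift) (cylinder \<tau>) = ennreal (1 / 2 ^ length \<tau>)"
      by (subst emeasure_distr) (simp_all)
  qed simp
  have "distr \<mu> borel (left_shift ^^ Suc k) = distr (distr \<mu> borel (left_shift ^^ k)) borel left_shift"
    by (subst distr_distr) simp_all
  then show ?case by (simp only: Suc shift)
qed

section \<open>Integration along the shift and independence of prefix and tail\<close>

lemma integral_shift:
  fixes g :: "(nat \<Rightarrow> bool) \<Rightarrow> real"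
  assumes [measurable]: "g \<in> borel_measurable borel"
  shows "(LINT \<omega>|\<mu>. g ((left_shift ^^ k) \<omega>)) = (LINT \<omega>|\<mu>. g \<omega>)"
proof -
  have "(LINT \<omega>|\<mu>. g ((left_shift ^^ k) \<omega>)) = (LINT \<omega>|distr \<mu> borel (left_shift ^^ k). g \<omega>)"
    by (rule integral_distr[symmetric]) measurable
  then show ?thesis by (simp only: distr_shift)
qed

lemma integrable_shift:
  fixes g :: "(nat \<Rightarrow> bool) \<Rightarrow> real"
  assumes "integrable \<mu> g"
  shows "integrable \<mu> (\<lambda>\<omega>. g ((left_shift ^^ k) \<omega>))"
proof (rule integrable_distr[where T = "left_shift ^^ k" and M' = borel and f = g])
  show "left_shift ^^ k \<in> \<mu> \<rightarrow>\<^sub>M borel" by measurable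
  show "integrable (distr \<mu> borel (left_shift ^^ k)) g" unfolding distr_shift by (rule assms)
qed

text \<open>This is \<open>distr_shift_conditioned\<close> for integrals: write \<open>\<mu>\<close>
  on the right as the pushforward of the conditioned measure, then unfold pushforward and
  density.\<close>

lemma integral_indicator_cylinder_shift:
  fixes g :: "(nat \<Rightarrow> bool) \<Rightarrow> real"
  assumes [measurable]: "g \<in> borel_measurable borel"
  shows "(LINT \<omega>|\<mu>. indicator (cylinder \<sigma>) \<omega> * g ((left_shift ^^ length \<sigma>) \<omega>)) =
    (LINT \<omega>|\<mu>. g \<omega>) / 2 ^ length \<sigma>"
proof -
  let ?D = "density \<mu> (\<lambda>\<omega>. ennreal (2 ^ length \<sigma> * indicator (cylinder \<sigma>) \<omega>))"
  have "(LINT \<omega>|\<mu>. g \<omega>) = (LINT \<omega>|?D. g ((left_shift ^^ length \<sigma>) \<omega>))"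
    by (subst distr_shift_conditioned[of \<sigma>, symmetric], rule integral_distr) measurable
  also have "\<dots> = (LINT \<omega>|\<mu>. (2 ^ length \<sigma> * indicator (cylinder \<sigma>) \<omega>) *\<^sub>R g ((left_shift ^^ length \<sigma>) \<omega>))"
    by (rule integral_density) measurable
  also have "\<dots> = 2 ^ length \<sigma> * (LINT \<omega>|\<mu>. indicator (cylinder \<sigma>) \<omega> * g ((left_shift ^^ length \<sigma>) \<omega>))"
    by (simp add: mult.assoc)
  finally show ?thesis by simp
qed

lemma depends_on_prefix_integrable:
  fixes h :: "(nat \<Rightarrow> bool) \<Rightarrow> real"
  assumes "depends_on_prefix p h"
  shows "integrable \<mu> h"
proof -
  have "integrable \<mu> (\<lambda>\<omega>. h (zero_extend \<sigma>) * indicator (cylinder \<sigma>) \<omega>)" for \<sigma>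
    by (intro integrable_mult_right integrable_real_indicator)
      (simp_all add: sets_eq_borel emeasure_cylinder)
  then show ?thesis
    by (subst depends_on_prefix_expansion[OF assms]) (rule Bochner_Integration.integrable_sum)
qed

text \<open>By linearity from the case of one cylinder, after expanding \<open>h\<close> over the
  strings of length \<open>k\<close>.\<close>

lemma integral_prefix_mult_shift:
  fixes g h :: "(nat \<Rightarrow> bool) \<Rightarrow> real"
  assumes h: "depends_on_prefix k h" and g: "integrable \<mu> g"
  shows "(LINT \<omega>|\<mu>. h \<omega> * g ((left_shift ^^ k) \<omega>)) = (LINT \<omega>|\<mu>. h \<omega>) * (LINT \<omega>|\<mu>. g \<omega>)"
proof -
  have [measurable]: "g \<in> borel_measurable borel" using g sets_eq_borel by auto
  define L where "L = {\<sigma> :: bool list. length \<sigma> = k}"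
  define c where "c \<sigma> = h (zero_extend \<sigma>)" for \<sigma>
  have h_eq: "h = (\<lambda>\<omega>. \<Sum>\<sigma>\<in>L. c \<sigma> * indicator (cylinder \<sigma>) \<omega>)"
    unfolding L_def c_def by (rule depends_on_prefix_expansion[OF h])
  have "integrable \<mu> (\<lambda>\<omega>. indicator (cylinder \<sigma>) \<omega> * g ((left_shift ^^ k) \<omega>))" for \<sigma>
    using integrable_mult_indicator[OF _ integrable_shift[OF g], of "cylinder \<sigma>" k]
    by (simp add: sets_eq_borel)
  then have "(LINT \<omega>|\<mu>. (\<Sum>\<sigma>\<in>L. c \<sigma> * (indicator (cylinder \<sigma>) \<omega> * g ((left_shift ^^ k) \<omega>)))) =
      (\<Sum>\<sigma>\<in>L. c \<sigma> * (LINT \<omega>|\<mu>. indicator (cylinder \<sigma>) \<omega> * g ((left_shift ^^ k) \<omega>)))"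
    by simp
  also have "\<dots> = (\<Sum>\<sigma>\<in>L. c \<sigma> / 2 ^ length \<sigma> * (LINT \<omega>|\<mu>. g \<omega>))"
    using integral_indicator_cylinder_shift[of g]
    by (intro sum.cong refl) (auto simp: L_def)
  also have "\<dots> = (\<Sum>\<sigma>\<in>L. c \<sigma> / 2 ^ length \<sigma>) * (LINT \<omega>|\<mu>. g \<omega>)"
    by (simp add: sum_distrib_right)
  also have "(\<Sum>\<sigma>\<in>L. c \<sigma> / 2 ^ length \<sigma>) = (LINT \<omega>|\<mu>. h \<omega>)"
    unfolding h_eq by (simp add: sets_eq_borel less_top[symmetric] measure_cylinder)
  finally show ?thesis
    by (subst h_eq) (simp add: sum_distrib_right mult.assoc)
qed

text \<open>The cylinder of length \<open>p\<close> around \<open>\<omega>\<close> has mass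
  \<open>1 / 2 ^ p\<close> and \<open>g\<close> is constant on it, so it alone contributes
  \<open>\<bar>g \<omega>\<bar> / 2 ^ p\<close> to the integral.\<close>

lemma prefix_bound:
  fixes g :: "(nat \<Rightarrow> bool) \<Rightarrow> real"
  assumes g: "depends_on_prefix p g"
  shows "\<bar>g \<omega>\<bar> \<le> 2 ^ p * (LINT x|\<mu>. \<bar>g x\<bar>)"
proof -
  let ?s = "map \<omega> [0..<p]"
  have "\<bar>g \<omega>\<bar> / 2 ^ p = (LINT x|\<mu>. indicator (cylinder ?s) x * \<bar>g \<omega>\<bar>)"
    by (simp add: measure_cylinder)
  also have "\<dots> \<le> (LINT x|\<mu>. \<bar>g x\<bar>)"
  proof (rule integral_mono)
    show "integrable \<mu> (\<lambda>x. indicator (cylinder ?s) x * \<bar>g \<omega>\<bar>)"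
      by (simp add: sets_eq_borel less_top[symmetric])
    show "integrable \<mu> (\<lambda>x. \<bar>g x\<bar>)"
      using depends_on_prefix_integrable[OF g] by simp
    fix x
    have "g x = g \<omega>" if "x \<in> cylinder ?s"
      using that g by (auto simp: cylinder_def depends_on_prefix_def)
    then show "indicator (cylinder ?s) x * \<bar>g \<omega>\<bar> \<le> \<bar>g x\<bar>"
      by (auto simp: indicator_def)
  qed
  finally show ?thesis by (simp add: field_simps)
qed

text \<open>Invariance moves \<open>i\<close> to 0. The gap \<open>j - i\<close> is at least
  \<open>p\<close>, so the second factor sees only bits beyond those that determine the first, and
  the integral factors into a product of zero means.\<close>

lemma integral_shift_mult_shift:
  fixes h :: "(nat \<Rightarrow> bool) \<Rightarrow> real"
  assumes h: "depends_on_prefix p h" and mean: "(LINT \<omega>|\<mu>. h \<omega>) = 0" and ij: "i + p \<le> j"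
  shows "(LINT \<omega>|\<mu>. h ((left_shift ^^ i) \<omega>) * h ((left_shift ^^ j) \<omega>)) = 0"
proof -
  have [measurable]: "h \<in> borel_measurable borel" by (rule depends_on_prefix_measurable[OF h])
  have j: "(left_shift ^^ j) \<omega> = (left_shift ^^ (j - i)) ((left_shift ^^ i) \<omega>)" for \<omega>
    using ij by (simp add: funpow_left_shift add.assoc)
  have "(LINT \<omega>|\<mu>. h ((left_shift ^^ i) \<omega>) * h ((left_shift ^^ j) \<omega>)) =
      (LINT \<omega>|\<mu>. h \<omega> * h ((left_shift ^^ (j - i)) \<omega>))"
    unfolding j by (rule integral_shift[of "\<lambda>\<omega>. h \<omega> * h ((left_shift ^^ (j - i)) \<omega>)"]) measurable
  also have "\<dots> = 0"
    using integral_prefix_mult_shift[of "j - i" h h] depends_on_prefix_mono[OF h, of "j - i"]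
      depends_on_prefix_integrable[OF h] ij mean by simp
  finally show ?thesis .
qed

section \<open>Second moment of Birkhoff sums\<close>

lemma integrable_bounded:
  fixes g :: "(nat \<Rightarrow> bool) \<Rightarrow> real"
  assumes "g \<in> borel_measurable borel" "\<And>\<omega>. \<bar>g \<omega>\<bar> \<le> B"
  shows "integrable \<mu> g"
  by (rule integrable_const_bound[of _ B]) (use assms sets_eq_borel in auto)

text \<open>Expand the square into an n by n array of correlations. Entries at distance at least
  \<open>p\<close> from the diagonal vanish, the others are at most \<open>B\<^sup>2\<close>, and
  each row has at most \<open>2 * p\<close> of them.\<close>

lemma integral_birkhoff_sum_square_le:
  fixes h :: "(nat \<Rightarrow> bool) \<Rightarrow> real"
  assumes h: "depends_on_prefix p h" and mean: "(LINT \<omega>|\<mu>. h \<omega>) = 0"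
    and B: "\<And>\<omega>. \<bar>h \<omega>\<bar> \<le> B"
  shows "integrable \<mu> (\<lambda>\<omega>. (\<Sum>i<n. h ((left_shift ^^ i) \<omega>))\<^sup>2)" (is "integrable _ ?S")
    and "(LINT \<omega>|\<mu>. (\<Sum>i<n. h ((left_shift ^^ i) \<omega>))\<^sup>2) \<le> 2 * real n * real p * B\<^sup>2"
proof -
  have [measurable]: "h \<in> borel_measurable borel" by (rule depends_on_prefix_measurable[OF h])
  define r where "r i j \<omega> = h ((left_shift ^^ i) \<omega>) * h ((left_shift ^^ j) \<omega>)" for i j \<omega>
  have r_le: "\<bar>r i j \<omega>\<bar> \<le> B\<^sup>2" for i j \<omega>
    unfolding r_def abs_mult power2_eq_square
    by (intro mult_mono B) (use B[of \<omega>] in auto)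
  have r_int: "integrable \<mu> (r i j)" for i j
    by (rule integrable_bounded[OF _ r_le]) (simp add: r_def[abs_def])
  have S: "?S = (\<lambda>\<omega>. \<Sum>i<n. \<Sum>j<n. r i j \<omega>)"
    by (simp add: power2_eq_square sum_product r_def)
  show "integrable \<mu> ?S" unfolding S using r_int by simp
  have row: "(\<Sum>j<n. (LINT \<omega>|\<mu>. r i j \<omega>)) \<le> 2 * real p * B\<^sup>2" for i
  proof -
    \<comment> \<open>The window consists of the \<open>j\<close> at distance less than
      \<open>p\<close> from \<open>i\<close>. Truncated subtraction cuts it off at 0 as wanted, and
      for \<open>p = 0\<close> it is empty.\<close>
    have "(LINT \<omega>|\<mu>. r i j \<omega>) \<le> (if j \<in> {i + 1 - p..<i + p} then B\<^sup>2 else 0)" for j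
    proof (cases "j \<in> {i + 1 - p..<i + p}")
      case True
      have "(LINT \<omega>|\<mu>. r i j \<omega>) \<le> (LINT \<omega>|\<mu>. B\<^sup>2)"
        by (rule integral_mono) (use r_int r_le[THEN abs_le_D1] in auto)
      with True show ?thesis by (simp add: prob_space[simplified])
    next
      case False
      then consider "i + p \<le> j" | "j + p \<le> i" by fastforce
      then have "(LINT \<omega>|\<mu>. r i j \<omega>) = 0"
        using integral_shift_mult_shift[OF h mean, of i j] integral_shift_mult_shift[OF h mean, of j i]
        by cases (auto simp: r_def mult.commute)
      with False show ?thesis by simp
    qed
    then have "(\<Sum>j<n. LINT \<omega>|\<mu>. r i j \<omega>) \<le> (\<Sum>j<n. if j \<in> {i + 1 - p..<i + p} then B\<^sup>2 else 0)"
      by (intro sum_mono)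
    also have "\<dots> = real (card ({..<n} \<inter> {i + 1 - p..<i + p})) * B\<^sup>2"
      by (simp add: sum.If_cases del: atLeastLessThan_iff)
    also have "\<dots> \<le> (2 * real p) * B\<^sup>2"
    proof (rule mult_right_mono)
      have "card ({..<n} \<inter> {i + 1 - p..<i + p}) \<le> card {i + 1 - p..<i + p}"
        by (intro card_mono) auto
      also have "\<dots> \<le> 2 * p" by simp
      finally show "real (card ({..<n} \<inter> {i + 1 - p..<i + p})) \<le> 2 * real p" by linarith
    qed simp
    finally show ?thesis .
  qed
  have "(LINT \<omega>|\<mu>. ?S \<omega>) = (\<Sum>i<n. \<Sum>j<n. LINT \<omega>|\<mu>. r i j \<omega>)"
    unfolding S using r_int by simp
  also have "\<dots> \<le> (\<Sum>i<n. 2 * real p * B\<^sup>2)" by (intro sum_mono row)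
  finally show "(LINT \<omega>|\<mu>. ?S \<omega>) \<le> 2 * real n * real p * B\<^sup>2" by (simp add: mult_ac)
qed

section \<open>Norm estimates for ergodic averages\<close>

lemma ergodic_average_integrable:
  assumes "integrable \<mu> g"
  shows "integrable \<mu> (ergodic_average g n)"
  unfolding ergodic_average_def[abs_def] using integrable_shift[OF assms] by simp

text \<open>A pointwise AM-GM inequality with weight \<open>e\<close> replaces Cauchy-Schwarz in
  passing from the second moment to the norm. The constant term is \<open>e / 2\<close>, and the
  lower bound on \<open>n\<close> makes the quadratic term integrate to at most
  \<open>e / 2\<close>.\<close>

lemma l1_norm_ergodic_average_centered_le:
  assumes h: "depends_on_prefix p h" and mean: "(LINT \<omega>|\<mu>. h \<omega>) = 0"
    and B: "\<And>\<omega>. \<bar>h \<omega>\<bar> \<le> B" and e: "e > 0" and n: "n > 0" "2 * real p * B\<^sup>2 \<le> e\<^sup>2 * real n"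
  shows "l1_norm \<mu> (ergodic_average h n) \<le> e"
proof -
  let ?S = "\<lambda>\<omega>. \<Sum>i<n. h ((left_shift ^^ i) \<omega>)"
  note S = integral_birkhoff_sum_square_le[OF h mean B, of n]
  have AM_GM: "\<bar>ergodic_average h n \<omega>\<bar> \<le> e / 2 + (?S \<omega>)\<^sup>2 / (2 * e * (real n)\<^sup>2)" for \<omega>
  proof -
    define a where "a = \<bar>?S \<omega>\<bar> / real n"
    have "0 \<le> (a - e)\<^sup>2 / (2 * e)" using e by simp
    also have "\<dots> = e / 2 + a\<^sup>2 / (2 * e) - a"
      using e by (simp add: field_simps power2_eq_square)
    finally have "a \<le> e / 2 + a\<^sup>2 / (2 * e)" by simp
    moreover have "\<bar>ergodic_average h n \<omega>\<bar> = a"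
      by (simp add: ergodic_average_def a_def abs_mult)
    moreover have "a\<^sup>2 / (2 * e) = (?S \<omega>)\<^sup>2 / (2 * e * (real n)\<^sup>2)"
      by (simp add: a_def power_divide)
    ultimately show ?thesis by simp
  qed
  have "l1_norm \<mu> (ergodic_average h n) \<le> (LINT \<omega>|\<mu>. e / 2 + (?S \<omega>)\<^sup>2 / (2 * e * (real n)\<^sup>2))"
    unfolding l1_norm_def
    using S(1) ergodic_average_integrable[OF depends_on_prefix_integrable[OF h], of n]
    by (intro integral_mono AM_GM) auto
  also have "\<dots> = e / 2 + (LINT \<omega>|\<mu>. (?S \<omega>)\<^sup>2) / (2 * e * (real n)\<^sup>2)"
    using S(1) by (simp add: prob_space[simplified])
  also have "\<dots> \<le> e / 2 + (2 * real n * real p * B\<^sup>2) / (2 * e * (real n)\<^sup>2)"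
    using S(2) e by (intro add_left_mono divide_right_mono) auto
  also have "(2 * real n * real p * B\<^sup>2) / (2 * e * (real n)\<^sup>2) = (2 * real p * B\<^sup>2) / (2 * e * real n)"
    using n(1) by (simp add: power2_eq_square)
  also have "\<dots> \<le> (e\<^sup>2 * real n) / (2 * e * real n)"
    using n e by (intro divide_right_mono) auto
  also have "\<dots> = e / 2" using n(1) e by (simp add: power2_eq_square)
  finally show ?thesis by simp
qed

text \<open>By invariance every summand has the norm of \<open>g\<close>, so averaging is a
  contraction; for \<open>n = 0\<close> the average is 0.\<close>

lemma l1_norm_ergodic_average_le:
  assumes "integrable \<mu> g"
  shows "l1_norm \<mu> (ergodic_average g n) \<le> l1_norm \<mu> g"
proof -
  have [measurable]: "g \<in> borel_measurable borel" using assms sets_eq_borel by auto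
  note int = integrable_shift[OF assms]
  have "l1_norm \<mu> (ergodic_average g n) \<le> (LINT \<omega>|\<mu>. (1 / real n) * (\<Sum>i<n. \<bar>g ((left_shift ^^ i) \<omega>)\<bar>))"
    unfolding l1_norm_def
  proof (rule integral_mono)
    show "integrable \<mu> (\<lambda>\<omega>. \<bar>ergodic_average g n \<omega>\<bar>)"
      using ergodic_average_integrable[OF assms, of n] by simp
    show "integrable \<mu> (\<lambda>\<omega>. (1 / real n) * (\<Sum>i<n. \<bar>g ((left_shift ^^ i) \<omega>)\<bar>))"
      using int by simp
    show "\<bar>ergodic_average g n \<omega>\<bar> \<le> (1 / real n) * (\<Sum>i<n. \<bar>g ((left_shift ^^ i) \<omega>)\<bar>)" for \<omega>
      unfolding ergodic_average_def abs_mult by (intro mult_mono sum_abs) auto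
  qed
  also have "\<dots> = (1 / real n) * (\<Sum>i<n. LINT \<omega>|\<mu>. \<bar>g ((left_shift ^^ i) \<omega>)\<bar>)"
    using int by simp
  also have "\<dots> = (1 / real n) * (\<Sum>i<n. l1_norm \<mu> g)"
    using integral_shift[of "\<lambda>\<omega>. \<bar>g \<omega>\<bar>"] by (simp add: l1_norm_def)
  also have "\<dots> \<le> l1_norm \<mu> g" by (simp add: l1_norm_def)
  finally show ?thesis .
qed

lemma l1_norm_add_le:
  assumes "integrable \<mu> u" "integrable \<mu> v"
  shows "l1_norm \<mu> (\<lambda>\<omega>. u \<omega> + v \<omega>) \<le> l1_norm \<mu> u + l1_norm \<mu> v"
proof -
  have "l1_norm \<mu> (\<lambda>\<omega>. u \<omega> + v \<omega>) \<le> (LINT \<omega>|\<mu>. \<bar>u \<omega>\<bar> + \<bar>v \<omega>\<bar>)"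
    unfolding l1_norm_def using assms by (intro integral_mono) auto
  with assms show ?thesis by (simp add: l1_norm_def)
qed

text \<open>With \<open>h\<close> the centred \<open>g\<close> and \<open>d = f - g\<close>, the
  deviation of the average of \<open>f\<close> from its mean is the average of \<open>h\<close> plus
  the average of \<open>d\<close> minus the integral of \<open>d\<close>. The first term is allotted
  half of the error, the other two a quarter each.\<close>

lemma l1_norm_ergodic_average_le_prefix:
  assumes f: "integrable \<mu> f" and g: "depends_on_prefix p g"
    and fg: "l1_norm \<mu> (\<lambda>\<omega>. f \<omega> - g \<omega>) \<le> 1 / 2 ^ (m + 2)"
    and c: "l1_norm \<mu> g \<le> 2 ^ c"
    and n: "n \<ge> 2 ^ (4 * p + 2 * c + 2 * m + 4)"
  shows "l1_norm \<mu> (\<lambda>\<omega>. ergodic_average f n \<omega> - (LINT x|\<mu>. f x)) \<le> 1 / 2 ^ m"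
proof -
  define h where "h \<omega> = g \<omega> - (LINT x|\<mu>. g x)" for \<omega>
  define d where "d \<omega> = f \<omega> - g \<omega>" for \<omega>
  have g_int: "integrable \<mu> g" by (rule depends_on_prefix_integrable[OF g])
  have d_int: "integrable \<mu> d" unfolding d_def[abs_def] using f g_int by simp
  have h: "depends_on_prefix p h" unfolding h_def[abs_def] by (rule depends_on_prefix_comp[OF g])
  have mean: "(LINT \<omega>|\<mu>. h \<omega>) = 0" using g_int by (simp add: h_def prob_space[simplified])
  have "0 < (2 :: nat) ^ (4 * p + 2 * c + 2 * m + 4)" by simp
  with n have n0: "n > 0" by linarith
  \<comment> \<open>Both \<open>g\<close> and its mean are bounded by \<open>2 ^ (p + c)\<close>,
    whence the additional factor 2.\<close>
  have B: "\<bar>h \<omega>\<bar> \<le> 2 ^ (p + c + 1)" for \<omega>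
  proof -
    have "\<bar>g \<omega>\<bar> \<le> 2 ^ p * l1_norm \<mu> g" using prefix_bound[OF g] by (simp add: l1_norm_def)
    also have "\<dots> \<le> 2 ^ p * 2 ^ c" using c by simp
    finally have 1: "\<bar>g \<omega>\<bar> \<le> 2 ^ (p + c)" by (simp add: power_add)
    have "\<bar>LINT x|\<mu>. g x\<bar> \<le> l1_norm \<mu> g" unfolding l1_norm_def by (rule integral_abs_bound)
    also have "\<dots> \<le> 2 ^ (p + c)" using c by (rule order_trans) simp
    finally show ?thesis using 1 unfolding h_def by simp
  qed
  define e :: real where "e = 1 / 2 ^ (m + 1)"
  have e_sq: "e\<^sup>2 = 1 / 2 ^ (2 * m + 2)"
    unfolding e_def power_divide power_mult[symmetric] by simp
  have four: "(4 :: real) ^ p = 2 ^ (2 * p)" by (simp add: power_mult)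
  \<comment> \<open>Absorbs the linear factor of the second moment bound into a power of 2, so that
    the threshold for \<open>n\<close> is a pure power of 2.\<close>
  have "2 * real p \<le> 4 ^ p"
  proof (induction p)
    case (Suc p)
    have "2 * real p + 2 * 1 \<le> 4 ^ p + 2 * 4 ^ p"
      using Suc by (intro add_mono mult_left_mono) simp_all
    also have "\<dots> \<le> 4 ^ Suc p" by simp
    finally show ?case by simp
  qed simp
  then have "2 * real p * (2 ^ (p + c + 1))\<^sup>2 \<le> 4 ^ p * (2 ^ (p + c + 1))\<^sup>2"
    by (intro mult_right_mono) auto
  also have "\<dots> = 2 ^ (4 * p + 2 * c + 2)"
    unfolding four power_mult[symmetric] power_add[symmetric]
    by (rule arg_cong[where f = "\<lambda>k. 2 ^ k"]) simp
  \<comment> \<open>The exponent of the threshold exceeds the previous one by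
    \<open>2 * m + 2\<close>, exactly what \<open>e\<^sup>2\<close> takes away.\<close>
  also have "\<dots> = e\<^sup>2 * 2 ^ (4 * p + 2 * c + 2 * m + 4)"
    by (simp add: e_sq power_add)
  also have "\<dots> \<le> e\<^sup>2 * real n"
    using n by (intro mult_left_mono) simp_all
  finally have "l1_norm \<mu> (ergodic_average h n) \<le> e"
    by (intro l1_norm_ergodic_average_centered_le[OF h mean B _ n0]) (simp_all add: e_def)
  moreover have "l1_norm \<mu> (ergodic_average d n) \<le> 1 / 2 ^ (m + 2)"
    using l1_norm_ergodic_average_le[OF d_int] fg unfolding d_def by (rule order_trans)
  moreover have "l1_norm \<mu> (\<lambda>_. - (LINT x|\<mu>. d x)) \<le> 1 / 2 ^ (m + 2)"
  proof -
    have "l1_norm \<mu> (\<lambda>_. - (LINT x|\<mu>. d x)) = \<bar>LINT x|\<mu>. d x\<bar>"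
      by (simp only: l1_norm_def abs_minus_cancel) (simp add: prob_space[simplified])
    also have "\<dots> \<le> l1_norm \<mu> d" unfolding l1_norm_def by (rule integral_abs_bound)
    also have "\<dots> \<le> 1 / 2 ^ (m + 2)" using fg unfolding d_def .
    finally show ?thesis .
  qed
  moreover have "l1_norm \<mu> (\<lambda>\<omega>. ergodic_average f n \<omega> - (LINT x|\<mu>. f x)) \<le>
      l1_norm \<mu> (ergodic_average h n) + (l1_norm \<mu> (ergodic_average d n) + l1_norm \<mu> (\<lambda>_. - (LINT x|\<mu>. d x)))"
  proof -
    note int = ergodic_average_integrable[OF depends_on_prefix_integrable[OF h], of n]
      ergodic_average_integrable[OF d_int, of n]
    \<comment> \<open>The mean of \<open>g\<close> subtracted in \<open>h\<close> is recovered by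
      averaging a constant, which requires \<open>n > 0\<close>.\<close>
    have "ergodic_average f n \<omega> - (LINT x|\<mu>. f x) =
        ergodic_average h n \<omega> + (ergodic_average d n \<omega> + - (LINT x|\<mu>. d x))" for \<omega>
      using n0 f g_int
      by (simp add: ergodic_average_def h_def d_def sum_subtractf field_simps)
    then have "l1_norm \<mu> (\<lambda>\<omega>. ergodic_average f n \<omega> - (LINT x|\<mu>. f x)) =
        l1_norm \<mu> (\<lambda>\<omega>. ergodic_average h n \<omega> + (ergodic_average d n \<omega> + - (LINT x|\<mu>. d x)))"
      by simp
    also have "\<dots> \<le> l1_norm \<mu> (ergodic_average h n) +
        l1_norm \<mu> (\<lambda>\<omega>. ergodic_average d n \<omega> + - (LINT x|\<mu>. d x))"
      using int by (intro l1_norm_add_le) auto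
    also have "l1_norm \<mu> (\<lambda>\<omega>. ergodic_average d n \<omega> + - (LINT x|\<mu>. d x)) \<le>
        l1_norm \<mu> (ergodic_average d n) + l1_norm \<mu> (\<lambda>_. - (LINT x|\<mu>. d x))"
      using int by (intro l1_norm_add_le) auto
    finally show ?thesis by simp
  qed
  moreover have "e + (1 / 2 ^ (m + 2) + 1 / 2 ^ (m + 2)) = 1 / 2 ^ m"
    by (simp add: e_def field_simps)
  ultimately show ?thesis by linarith
qed

end

section \<open>The polynomial rate of convergence\<close>

theorem theorem3p10:
  fixes \<mu> :: "(nat \<Rightarrow> bool) measure" and f :: "(nat \<Rightarrow> bool) \<Rightarrow> real"
    and rep :: "bool list \<Rightarrow> rat option"
  assumes "sets \<mu> = sets borel"
    and "\<And>\<sigma>. emeasure \<mu> (cylinder \<sigma>) = ennreal (1 / 2 ^ length \<sigma>)"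
    and "integrable \<mu> f"
    and "rat_representation rep"
    and "pspace_L1_computable rep \<mu> f"
  shows "\<exists>q. polynomial_fun q \<and>
    (\<forall>m>0. \<forall>n\<ge>2 ^ q m.
       l1_norm \<mu> (\<lambda>\<omega>. ergodic_average f n \<omega> - (LINT x|\<mu>. f x)) \<le> 1 / 2 ^ m)"
proof -
  interpret bernoulli_measure \<mu> by standard (fact assms(1), fact assms(2))
  obtain F where F: "pspace_simple_sequence rep F"
    and close: "\<And>n. n > 0 \<Longrightarrow> l1_norm \<mu> (\<lambda>\<omega>. f \<omega> - of_rat (F n \<omega>)) \<le> 1 / 2 ^ n"
    using assms(5) unfolding pspace_L1_computable_def by blast
  obtain p where p: "polynomial_fun p"
    and simple: "\<And>n. n > 0 \<Longrightarrow> \<exists>k>0. \<exists>d :: nat \<Rightarrow> rat. \<exists>s :: nat \<Rightarrow> bool list.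
           (\<forall>i\<in>{1..k}. length (s i) = p n) \<and>
           (\<forall>\<omega>. F n \<omega> = (\<Sum>i=1..k. d i * indicator (cylinder (s i)) \<omega>))"
    using F unfolding pspace_simple_sequence_def by blast
  have prefix: "depends_on_prefix (p n) (\<lambda>\<omega>. real_of_rat (F n \<omega>))" if n: "n > 0" for n
  proof (rule depends_on_prefix_comp[where \<phi> = real_of_rat])
    obtain k s and d :: "nat \<Rightarrow> rat" where len: "\<And>i. i \<in> {1..k} \<Longrightarrow> length (s i) = p n"
      and Fn: "\<And>\<omega>. F n \<omega> = (\<Sum>i=1..k. d i * indicator (cylinder (s i)) \<omega>)"
      using simple[OF n] by blast
    \<comment> \<open>Every string in the sum has length \<open>p n\<close>, so each indicator is
      settled by the first \<open>p n\<close> bits.\<close>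
    show "depends_on_prefix (p n) (F n)"
      unfolding depends_on_prefix_def Fn
      by (intro allI impI sum.cong refl) (auto simp: indicator_def cylinder_def len)
  qed
  \<comment> \<open>The summand 1 covers the approximation error, so \<open>2 ^ c\<close> bounds the
    norms of all the approximants used. As \<open>c\<close> does not depend on \<open>m\<close>, it
    enters \<open>q\<close> only as a constant.\<close>
  obtain c :: nat where c: "l1_norm \<mu> f + 1 \<le> 2 ^ c"
    using real_arch_pow[of 2 "l1_norm \<mu> f + 1"] by (auto intro: less_imp_le)
  \<comment> \<open>The index \<open>m + 2\<close> gives approximation error
    \<open>1 / 2 ^ (m + 2)\<close>; the rest is the exponent from
    \<open>l1_norm_ergodic_average_le_prefix\<close>.\<close>
  define q where "q m = 4 * p (m + 2) + 2 * c + 2 * m + 4" for m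
  have "polynomial_fun q"
  proof -
    obtain P :: "real poly" where P: "\<And>n. n > 0 \<Longrightarrow> real (p n) = poly P (real n)"
      using p unfolding polynomial_fun_def by blast
    \<comment> \<open>Composition with the polynomial X + 2 realizes the index shift. Since
      \<open>m + 2 > 0\<close>, the identity for \<open>p\<close> applies for every
      \<open>m\<close>.\<close>
    have "real (q m) = poly (smult 4 (pcompose P [:2, 1:]) + [:2 * real c + 4, 2:]) (real m)" for m
      using P[of "m + 2"] by (simp add: q_def poly_pcompose algebra_simps)
    then show ?thesis unfolding polynomial_fun_def by blast
  qed
  moreover have "l1_norm \<mu> (\<lambda>\<omega>. ergodic_average f n \<omega> - (LINT x|\<mu>. f x)) \<le> 1 / 2 ^ m"
    if "n \<ge> 2 ^ q m" for m n
  proof (rule l1_norm_ergodic_average_le_prefix[where c = c])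
    let ?g = "\<lambda>\<omega>. real_of_rat (F (m + 2) \<omega>)"
    show g: "depends_on_prefix (p (m + 2)) ?g" by (rule prefix) simp
    show fg: "l1_norm \<mu> (\<lambda>\<omega>. f \<omega> - ?g \<omega>) \<le> 1 / 2 ^ (m + 2)" by (rule close) simp
    have g_int: "integrable \<mu> ?g" by (rule depends_on_prefix_integrable[OF g])
    have "l1_norm \<mu> ?g = l1_norm \<mu> (\<lambda>\<omega>. f \<omega> + (?g \<omega> - f \<omega>))" by simp
    also have "\<dots> \<le> l1_norm \<mu> f + l1_norm \<mu> (\<lambda>\<omega>. ?g \<omega> - f \<omega>)"
      using assms(3) g_int by (intro l1_norm_add_le) auto
    also have "l1_norm \<mu> (\<lambda>\<omega>. ?g \<omega> - f \<omega>) = l1_norm \<mu> (\<lambda>\<omega>. f \<omega> - ?g \<omega>)"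
      by (simp add: l1_norm_def abs_minus_commute)
    also have "\<dots> \<le> 1 / 2 ^ (m + 2)" by (rule fg)
    also have "\<dots> \<le> (1 :: real)"
      unfolding divide_le_eq_1_pos[OF zero_less_power[OF zero_less_numeral]]
      by (rule one_le_power) simp
    finally show "l1_norm \<mu> ?g \<le> 2 ^ c" using c by simp
  qed (use assms(3) that in \<open>simp_all add: q_def\<close>)
  ultimately show ?thesis by blast
qed

end
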